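(* Let $\mathcal{A}$ be a commutative multiplicative unital nil algebra. Then the exponential function $\exp:\mathcal{A}\to\mathcal{A}$ is injective.
   Context: An algebra is a finite-dimensional associative commutative unital algebra over $\mathbb{R}$, with product $\star$ and unit $1$. The exponential function of an algebra $\mathcal{A}$ is $\exp(z)=e^z=\sum_{k=0}^\infty \frac{z^k}{k!}$, which converges for all $z\in\mathcal{A}$. A unital nil algebra is an algebra $\mathcal{A}$ having an $\mathbb{R}$-basis of the form $\{1,\epsilon_1,\dots,\epsilon_{n-1}\}$ in which each $\epsilon_k$ is nilpotent. A basis $\{v_1,\dots,v_n\}$ of an algebra is multiplicative if for all $i,j$ there are $c\in\mathbb{R}$ and a basis element $v_k$ with $v_i\star v_j=c\,v_k$; an algebra is multiplicative if it admits a multiplicative basis. *)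

theory Defs
  imports "HOL-Analysis.Analysis"
begin

text \<open>
  An algebra is a type of sort \<open>{real_normed_vector, real_algebra_1, comm_ring_1}\<close> with a finite
  basis. The norm only provides the canonical topology of a finite-dimensional space, in which the
  exponential series is summed. It is an arbitrary vector space norm, and nothing relates it to the
  product: the sort \<open>real_normed_algebra_1\<close>, on which the library's \<open>exp\<close> is defined,
  would in addition demand submultiplicativity and \<open>norm 1 = 1\<close>.
\<close>

definition alg_basis :: "'a::real_vector set \<Rightarrow> bool" where
  "alg_basis B \<longleftrightarrow> finite B \<and> independent B \<and> span B = UNIV"

definition nilpotent :: "'a::{power,zero} \<Rightarrow> bool" where
  "nilpotent z \<longleftrightarrow> (\<exists>k>0. z ^ k = 0)"

definition unital_nil_algebra :: "'a::{real_algebra_1,comm_ring_1} itself \<Rightarrow> bool" where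
  "unital_nil_algebra _ \<longleftrightarrow>
     (\<exists>E::'a set. 1 \<notin> E \<and> alg_basis (insert 1 E) \<and> (\<forall>e\<in>E. nilpotent e))"

definition multiplicative_basis :: "'a::{real_algebra_1,comm_ring_1} set \<Rightarrow> bool" where
  "multiplicative_basis B \<longleftrightarrow>
     alg_basis B \<and> (\<forall>u\<in>B. \<forall>v\<in>B. \<exists>c::real. \<exists>w\<in>B. u * v = c *\<^sub>R w)"

definition multiplicative_algebra :: "'a::{real_algebra_1,comm_ring_1} itself \<Rightarrow> bool" where
  "multiplicative_algebra _ \<longleftrightarrow> (\<exists>B::'a set. multiplicative_basis B)"

definition alg_exp :: "'a::{real_normed_vector,real_algebra_1,comm_ring_1} \<Rightarrow> 'a" where
  "alg_exp z = (\<Sum>k. z ^ k /\<^sub>R fact k)"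

lemma alg_exp_eq_exp:
  fixes z :: "'a::{real_normed_algebra_1,banach,comm_ring_1}"
  shows "alg_exp z = exp z"
  by (simp add: alg_exp_def exp_def)

lemma summable_alg_exp:
  fixes z :: "'a::{real_normed_vector,real_algebra_1,comm_ring_1}"
  assumes "alg_basis (B :: 'a set)"
  shows "summable (\<lambda>k. z ^ k /\<^sub>R fact k)"
proof -
  have fin: "finite B" and ind: "independent B" and sp: "span B = UNIV"
    using assms by (auto simp: alg_basis_def)
  define r where "r = representation B"
  have r_sum: "(\<Sum>b\<in>B. r x b *\<^sub>R b) = x" for x
    unfolding r_def by (rule real_vector.sum_representation_eq) (use fin ind sp in auto)
  have r_lin: "r (\<Sum>b\<in>B. c b *\<^sub>R f b) b' = (\<Sum>b\<in>B. c b * r (f b) b')" for c f b'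
    unfolding r_def using ind sp
    by (simp add: real_vector.representation_sum real_vector.representation_scale)
  define S where "S k = (\<Sum>b\<in>B. \<bar>r (z ^ k) b\<bar>)" for k
  define M where "M = (\<Sum>b\<in>B. \<Sum>b'\<in>B. \<bar>r (z * b) b'\<bar>)"
  have M: "(\<Sum>b'\<in>B. \<bar>r (z * b) b'\<bar>) \<le> M" if "b \<in> B" for b
    unfolding M_def using that fin by (intro member_le_sum) (auto intro: sum_nonneg)
  have M0: "0 \<le> M" unfolding M_def by (intro sum_nonneg) auto
  have step: "S (Suc k) \<le> M * S k" for k
  proof -
    have "z ^ Suc k = z * (\<Sum>b\<in>B. r (z ^ k) b *\<^sub>R b)" by (simp add: r_sum)
    also have "\<dots> = (\<Sum>b\<in>B. r (z ^ k) b *\<^sub>R (z * b))" by (simp add: sum_distrib_left)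
    finally have eq: "r (z ^ Suc k) b' = (\<Sum>b\<in>B. r (z ^ k) b * r (z * b) b')" for b'
      by (simp only: r_lin)
    have "S (Suc k) \<le> (\<Sum>b'\<in>B. \<Sum>b\<in>B. \<bar>r (z ^ k) b\<bar> * \<bar>r (z * b) b'\<bar>)"
      unfolding S_def eq by (intro sum_mono order.trans[OF sum_abs]) (simp add: abs_mult)
    also have "\<dots> = (\<Sum>b\<in>B. \<bar>r (z ^ k) b\<bar> * (\<Sum>b'\<in>B. \<bar>r (z * b) b'\<bar>))"
      by (subst sum.swap) (simp add: sum_distrib_left)
    also have "\<dots> \<le> (\<Sum>b\<in>B. \<bar>r (z ^ k) b\<bar> * M)"
      by (intro sum_mono mult_left_mono M) auto
    finally show ?thesis by (simp add: S_def sum_distrib_left sum_distrib_right mult.commute)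
  qed
  have S: "S k \<le> S 0 * M ^ k" for k
  proof (induction k)
    case (Suc k)
    have "S (Suc k) \<le> M * S k" by (rule step)
    also have "\<dots> \<le> M * (S 0 * M ^ k)" using Suc M0 by (rule mult_left_mono)
    finally show ?case by (simp add: mult_ac)
  qed simp
  have co: "summable (\<lambda>k. r (z ^ k) b / fact k)" if "b \<in> B" for b
  proof (rule summable_comparison_test')
    show "summable (\<lambda>k. S 0 * (inverse (fact k) * M ^ k))"
      by (intro summable_mult summable_exp)
    fix k :: nat
    have "\<bar>r (z ^ k) b\<bar> \<le> S k" unfolding S_def using that fin by (intro member_le_sum) auto
    with S[of k] have "\<bar>r (z ^ k) b\<bar> \<le> S 0 * M ^ k" by linarith
    then show "norm (r (z ^ k) b / fact k) \<le> S 0 * (inverse (fact k) * M ^ k)"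
      by (simp add: field_simps)
  qed
  have "summable (\<lambda>k. \<Sum>b\<in>B. (r (z ^ k) b / fact k) *\<^sub>R b)"
    by (intro summable_sum summable_scaleR_left co)
  moreover have "(\<Sum>b\<in>B. (r (z ^ k) b / fact k) *\<^sub>R b) = z ^ k /\<^sub>R fact k" for k
  proof -
    have "(\<Sum>b\<in>B. (r (z ^ k) b / fact k) *\<^sub>R b) = (\<Sum>b\<in>B. r (z ^ k) b *\<^sub>R b) /\<^sub>R fact k"
      by (simp add: scaleR_sum_right divide_inverse mult.commute)
    then show ?thesis by (simp add: r_sum)
  qed
  ultimately show ?thesis by simp
qed

end

theory Submission imports Defs begin

text \<open>
  In a unital nil algebra every element is \<open>a + n\<close> with \<open>a\<close> real and \<open>n\<close> nilpotent, because in a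
  commutative ring the nilpotent elements form an ideal, and in an algebra also a subspace
  (\<open>subspace_nilpotent\<close>, \<open>nilpotent_mult_right\<close>). Expanding \<open>(a + n)\<^sup>k\<close> binomially splits the
  exponential into \<open>e\<^sup>a\<close> times a polynomial in \<open>n\<close>, the truncated exponential series
  (\<open>alg_exp_of_real_plus_nilpotent\<close>).

  Suppose that \<open>exp (a + n) = exp (b + m)\<close>. Both truncated series are \<open>1\<close> plus a nilpotent, so
  \<open>e\<^sup>a - e\<^sup>b\<close> is a nilpotent real number; hence \<open>a = b\<close>, and the truncated series at \<open>n\<close> and \<open>m\<close>
  agree. Their difference factors as \<open>(n - m)\<close> times \<open>1\<close> plus a nilpotent
  (\<open>exp_trunc_diff_factor\<close>). Such a second factor is not a zero divisor, so \<open>n = m\<close>.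
\<close>

section \<open>Nilpotent elements\<close>

lemma nilpotent_power_zero_mono:
  fixes x :: "'a::comm_ring_1"
  assumes "x ^ k = 0" "k \<le> l"
  shows "x ^ l = 0"
  using assms by (metis le_add_diff_inverse mult_zero_left power_add)

lemma nilpotent_mult_right:
  fixes x y :: "'a::comm_ring_1"
  shows "nilpotent x \<Longrightarrow> nilpotent (x * y)"
  unfolding nilpotent_def by (metis mult_zero_left power_mult_distrib)

lemma nilpotent_power:
  fixes x :: "'a::comm_ring_1"
  assumes "nilpotent x" "0 < k"
  shows "nilpotent (x ^ k)"
  using nilpotent_mult_right[OF assms(1), of "x ^ (k - 1)"] assms(2)
  by (simp add: power_eq_if)

text \<open>
  If \<open>x\<^sup>k = 0\<close> and \<open>y\<^sup>l = 0\<close>, each term of the binomial expansion of \<open>(x + y)\<^bsup>k + l\<^esup>\<close> has \<open>x\<close> to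
  a power of at least \<open>k\<close> or \<open>y\<close> to a power of at least \<open>l\<close>.
\<close>

lemma nilpotent_add:
  fixes x y :: "'a::comm_ring_1"
  assumes "nilpotent x" "nilpotent y"
  shows "nilpotent (x + y)"
proof -
  obtain k l where k: "k > 0" "x ^ k = 0" and l: "l > 0" "y ^ l = 0"
    using assms unfolding nilpotent_def by blast
  have "of_nat ((k + l) choose i) * x ^ i * y ^ (k + l - i) = 0" for i
  proof (cases "k \<le> i")
    case True
    then show ?thesis using nilpotent_power_zero_mono[OF k(2)] by simp
  next
    case False
    then have "y ^ (k + l - i) = 0" by (intro nilpotent_power_zero_mono[OF l(2)]) simp
    then show ?thesis by simp
  qed
  then have "(x + y) ^ (k + l) = 0" by (simp add: binomial_ring)
  then show ?thesis unfolding nilpotent_def using k(1) by (intro exI[of _ "k + l"]) simp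
qed

lemma subspace_nilpotent:
  "subspace {x :: 'a::{real_algebra_1,comm_ring_1}. nilpotent x}"
proof (rule subspaceI)
  have "(0::'a) ^ 1 = 0" by simp
  then show "(0::'a) \<in> {x. nilpotent x}" unfolding nilpotent_def by blast
next
  fix c :: real and x :: 'a
  assume "x \<in> {x. nilpotent x}"
  then have "nilpotent (x * of_real c)" by (simp add: nilpotent_mult_right)
  then show "c *\<^sub>R x \<in> {x. nilpotent x}"
    by (simp add: scaleR_conv_of_real mult.commute)
qed (simp add: nilpotent_add)

lemma nilpotent_of_real_iff:
  "nilpotent (of_real c :: 'a::{real_algebra_1,comm_ring_1}) \<longleftrightarrow> c = 0"
proof
  assume "nilpotent (of_real c :: 'a)"
  then obtain k where "(of_real (c ^ k) :: 'a) = 0" unfolding nilpotent_def by auto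
  then show "c = 0" by (simp only: of_real_eq_0_iff) simp
next
  assume "c = 0"
  then show "nilpotent (of_real c :: 'a)" using subspace_0[OF subspace_nilpotent] by simp
qed

text \<open>
  From \<open>h (1 + u) = 0\<close> follows \<open>h = h (-u)\<close>, and iterating this gives \<open>h = h (-u)\<^sup>k\<close> for every
  \<open>k\<close>, which vanishes as soon as \<open>u\<^sup>k\<close> does.
\<close>

lemma one_plus_nilpotent_cancel:
  fixes h u :: "'a::comm_ring_1"
  assumes "nilpotent u" "h * (1 + u) = 0"
  shows "h = 0"
proof -
  obtain k where k: "u ^ k = 0" using assms(1) unfolding nilpotent_def by blast
  have "h * u + h = 0" using assms(2) by (simp add: distrib_left add.commute)
  then have "- (h * u) = h" by (rule minus_unique)
  then have h: "h * (- u) = h" by simp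
  have "h = h * (- u) ^ i" for i
  proof (induction i)
    case (Suc i)
    have "h * (- u) ^ Suc i = (h * (- u)) * (- u) ^ i" by (simp only: power_Suc mult.assoc)
    with h Suc show ?case by simp
  qed simp
  from this[of k] show ?thesis using k by (simp add: power_minus[of u])
qed

lemma unital_nil_algebra_decompose:
  fixes z :: "'a::{real_algebra_1,comm_ring_1}"
  assumes "unital_nil_algebra TYPE('a)"
  obtains a n where "z = of_real a + n" "nilpotent n"
proof -
  obtain E :: "'a set" where E: "span (insert 1 E) = UNIV" "\<forall>e\<in>E. nilpotent e"
    using assms unfolding unital_nil_algebra_def alg_basis_def by blast
  obtain a where "z - a *\<^sub>R 1 \<in> span E"
    using E(1) by (auto simp: span_insert)
  moreover have "span E \<subseteq> {x. nilpotent x}"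
    by (rule span_minimal) (use E(2) subspace_nilpotent in auto)
  ultimately have "nilpotent (z - of_real a)" by (auto simp: of_real_def)
  then show thesis using that[of a "z - of_real a"] by simp
qed

section \<open>The truncated exponential series\<close>

definition exp_trunc :: "nat \<Rightarrow> 'a::real_algebra_1 \<Rightarrow> 'a" where
  "exp_trunc N x = (\<Sum>j<N. x ^ j /\<^sub>R fact j)"

text \<open>
  Regrouping the binomial expansions by powers of \<open>n\<close> writes the exponential series as a finite
  combination of the vectors \<open>n\<^sup>j / j!\<close> whose coefficients are the series of \<open>e\<^sup>a\<close>, shifted by \<open>j\<close>.
  Thus every limit that is taken is one of real numbers.
\<close>

lemma alg_exp_of_real_plus_nilpotent:
  fixes n :: "'a::{real_normed_vector,real_algebra_1,comm_ring_1}"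
  assumes "n ^ N = 0"
  shows "alg_exp (of_real a + n) = exp a *\<^sub>R exp_trunc N n"
proof -
  define c where "c j k = (if k < j then 0 else a ^ (k - j) /\<^sub>R fact (k - j))" for j k :: nat
  have c_sums: "c j sums exp a" for j
  proof -
    have "(\<lambda>k. c j (k + j)) sums exp a" using exp_converges[of a] by (simp add: c_def)
    then show ?thesis by (subst (asm) sums_zero_iff_shift) (simp_all add: c_def)
  qed
  have expand: "(of_real a + n) ^ k /\<^sub>R fact k = (\<Sum>j<N. c j k *\<^sub>R (n ^ j /\<^sub>R fact j))" for k
  proof -
    have "(of_real a + n) ^ k /\<^sub>R fact k
        = (\<Sum>j\<le>k. (of_nat (k choose j) * n ^ j * of_real a ^ (k - j)) /\<^sub>R fact k)"
      by (simp only: add.commute[of "of_real a"] binomial_ring scaleR_sum_right)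
    also have "\<dots> = (\<Sum>j\<le>k. c j k *\<^sub>R (n ^ j /\<^sub>R fact j))"
    proof (rule sum.cong[OF refl])
      fix j assume "j \<in> {..k}"
      then have j: "j \<le> k" by simp
      have "of_nat (k choose j) * n ^ j * of_real a ^ (k - j)
          = (real (k choose j) * a ^ (k - j)) *\<^sub>R n ^ j"
        by (simp add: scaleR_conv_of_real mult_ac)
      then show "(of_nat (k choose j) * n ^ j * of_real a ^ (k - j)) /\<^sub>R fact k
          = c j k *\<^sub>R (n ^ j /\<^sub>R fact j)"
        using j by (simp add: c_def binomial_fact field_simps)
    qed
    \<comment> \<open>The terms with \<open>j > k\<close> vanish by the choice of \<open>c\<close>, those with \<open>j \<ge> N\<close> by \<open>n\<^sup>N = 0\<close>.\<close>
    also have "\<dots> = (\<Sum>j<N. c j k *\<^sub>R (n ^ j /\<^sub>R fact j))"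
    proof (rule sum.mono_neutral_cong)
      fix j assume "j \<in> {..k} - {..<N}"
      then have "n ^ j = 0" by (intro nilpotent_power_zero_mono[OF assms]) simp
      then show "c j k *\<^sub>R (n ^ j /\<^sub>R fact j) = 0" by simp
    qed (auto simp: c_def)
    finally show ?thesis .
  qed
  have "(\<lambda>k. \<Sum>j<N. c j k *\<^sub>R (n ^ j /\<^sub>R fact j)) sums (\<Sum>j<N. exp a *\<^sub>R (n ^ j /\<^sub>R fact j))"
    by (intro sums_sum sums_scaleR_left c_sums)
  then have "(\<lambda>k. (of_real a + n) ^ k /\<^sub>R fact k) sums (exp a *\<^sub>R exp_trunc N n)"
    by (simp only: expand exp_trunc_def scaleR_sum_right)
  then show ?thesis unfolding alg_exp_def by (rule sums_unique[symmetric])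
qed

lemma nilpotent_exp_trunc_minus_one:
  fixes n :: "'a::{real_algebra_1,comm_ring_1}"
  assumes "nilpotent n"
  shows "nilpotent (exp_trunc (Suc N) n - 1)"
proof -
  have "exp_trunc (Suc N) n - 1 = (\<Sum>j<N. n ^ Suc j /\<^sub>R fact (Suc j))"
    unfolding exp_trunc_def by (subst sum.lessThan_Suc_shift) simp
  also have "\<dots> \<in> {x. nilpotent x}"
    by (intro subspace_sum[OF subspace_nilpotent] subspace_scale[OF subspace_nilpotent])
       (simp del: power_Suc add: nilpotent_power[OF assms])
  finally show ?thesis by simp
qed

text \<open>
  Each \<open>n\<^sup>j - m\<^sup>j\<close> is \<open>n - m\<close> times a sum of monomials of degree \<open>j - 1\<close>. The linear terms
  contribute the factor \<open>1\<close>; all higher terms contribute monomials of positive degree, which are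
  nilpotent. At least two terms of the series are required for the linear one to occur.
\<close>

lemma exp_trunc_diff_factor:
  fixes n m :: "'a::{real_algebra_1,comm_ring_1}"
  assumes n: "nilpotent n" and m: "nilpotent m"
  obtains u where "nilpotent u"
    "exp_trunc (Suc (Suc N)) n - exp_trunc (Suc (Suc N)) m = (n - m) * (1 + u)"
proof -
  define q where "q j = (\<Sum>i<j. m ^ (j - Suc i) * n ^ i) /\<^sub>R fact j" for j
  have diff: "n ^ j /\<^sub>R fact j - m ^ j /\<^sub>R fact j = (n - m) * q j" for j
    by (simp add: q_def power_diff_sumr2 flip: scaleR_diff_right)
  have nil: "nilpotent (q (Suc (Suc j)))" for j
  proof -
    have "nilpotent (m ^ (Suc (Suc j) - Suc i) * n ^ i)" if "i < Suc (Suc j)" for i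
    proof (cases "i = 0")
      case True
      then show ?thesis using nilpotent_power[OF m, of "Suc j"] by simp
    next
      case False
      then have "nilpotent (n ^ i)" by (intro nilpotent_power[OF n]) simp
      then have "nilpotent (n ^ i * m ^ (Suc (Suc j) - Suc i))" by (rule nilpotent_mult_right)
      then show ?thesis by (simp only: mult.commute)
    qed
    then have "q (Suc (Suc j)) \<in> {x. nilpotent x}"
      unfolding q_def
      by (intro subspace_scale[OF subspace_nilpotent] subspace_sum[OF subspace_nilpotent]) auto
    then show ?thesis by simp
  qed
  define u where "u = (\<Sum>j<N. q (Suc (Suc j)))"
  have "u \<in> {x. nilpotent x}"
    unfolding u_def by (intro subspace_sum[OF subspace_nilpotent]) (simp add: nil)
  moreover have "exp_trunc (Suc (Suc N)) n - exp_trunc (Suc (Suc N)) m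
      = (n - m) * (\<Sum>j<Suc (Suc N). q j)"
    by (simp only: exp_trunc_def sum_subtractf[symmetric] diff sum_distrib_left)
  moreover have "(\<Sum>j<Suc (Suc N). q j) = 1 + u"
  proof -
    have "q 0 = 0" "q (Suc 0) = 1" by (simp_all add: q_def)
    then show ?thesis by (simp only: sum.lessThan_Suc_shift u_def add_0_left)
  qed
  ultimately show thesis using that by simp
qed

section \<open>Injectivity\<close>

theorem theorem2p17:
  assumes "unital_nil_algebra TYPE('a::{real_normed_vector,real_algebra_1,comm_ring_1})"
    and "multiplicative_algebra TYPE('a)"
  shows "inj (alg_exp :: 'a \<Rightarrow> 'a)"
proof (rule injI)
  fix z w :: 'a
  assume eq: "alg_exp z = alg_exp w"
  obtain a n where z: "z = of_real a + n" and n: "nilpotent n"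
    using unital_nil_algebra_decompose[OF assms(1)] by blast
  obtain b m where w: "w = of_real b + m" and m: "nilpotent m"
    using unital_nil_algebra_decompose[OF assms(1)] by blast
  obtain k l where kl: "n ^ k = 0" "m ^ l = 0"
    using n m unfolding nilpotent_def by blast
  \<comment> \<open>A common truncation order, at least two so that the linear term is present.\<close>
  define N where "N = Suc (Suc (k + l))"
  have "n ^ N = 0" "m ^ N = 0"
    unfolding N_def
    by (auto intro: nilpotent_power_zero_mono[OF kl(1)] nilpotent_power_zero_mono[OF kl(2)]
        simp del: power_Suc)
  then have eq': "exp a *\<^sub>R exp_trunc N n = exp b *\<^sub>R exp_trunc N m"
    using eq by (simp add: z w alg_exp_of_real_plus_nilpotent)
  have "of_real (exp a - exp b)
      = exp b *\<^sub>R (exp_trunc N m - 1) - exp a *\<^sub>R (exp_trunc N n - 1)"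
    by (simp add: scaleR_diff_right eq' of_real_def scaleR_diff_left)
  also have "\<dots> \<in> {x. nilpotent x}"
    unfolding N_def
    by (rule subspace_diff[OF subspace_nilpotent];
        rule subspace_scale[OF subspace_nilpotent], rule CollectI,
        rule nilpotent_exp_trunc_minus_one, fact)
  finally have ab: "a = b" by (simp only: mem_Collect_eq nilpotent_of_real_iff) simp
  obtain u where u: "nilpotent u"
    and factor: "exp_trunc N n - exp_trunc N m = (n - m) * (1 + u)"
    unfolding N_def by (rule exp_trunc_diff_factor[OF n m])
  have "exp_trunc N n = exp_trunc N m" using eq' by (simp add: ab)
  then have "(n - m) * (1 + u) = 0" by (simp only: factor[symmetric]) simp
  with u have "n - m = 0" by (rule one_plus_nilpotent_cancel)
  then show "z = w" by (simp add: z w ab)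
qed

end
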